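(* Let $G$ be a finite simple graph on vertex set $\{x_1,\ldots,x_n\}$ and let $\pi=\{W_1,\ldots,W_t\}$ be a clique vertex partition of $G$. Let $G^\pi$ be the clique-whiskered graph with vertex set $\{x_1,\ldots,x_n,w_1,\ldots,w_t\}$ ($w_i$ new vertices) and edge set $E(G)\cup\{\{x,w_i\}: x\in W_i,\ 1\le i\le t\}$. Then $G^\pi$ is vertex decomposable and $\mathrm{Shed}(G^\pi)$ is a dominating set of $G^\pi$.
   Context: A clique vertex partition of $G$ is a partition of the vertex set into disjoint subsets $W_1,\ldots,W_t$ such that each induced subgraph $G[W_i]$ is a complete graph. For a graph $G=(V,E)$ and $x\in V$, $G\setminus x$ is the graph obtained by deleting $x$ and its incident edges; $N(x)$ is the set of neighbours of $x$, $N[x]=N(x)\cup\{x\}$, and $G\setminus N[x]$ is obtained by deleting all vertices of $N[x]$ and their incident edges. A graph is well-covered if all its maximal independent sets have the same cardinality. A graph $G$ is vertex decomposable if $G$ is well-covered and either (i) $G$ has no edges (possibly no vertices), or (ii) there is a vertex $x$ such that both $G\setminus x$ and $G\setminus N[x]$ are vertex decomposable. For a vertex decomposable graph $G$, $\mathrm{Shed}(G)$ is the set of vertices $x$ such that $G\setminus x$ and $G\setminus N[x]$ are both vertex decomposable. A set $D\subseteq V$ is dominating if every vertex of $V\setminus D$ is adjacent to a vertex of $D$. *)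

theory Defs
  imports "HOL-Library.Ramsey" "HOL-Library.Disjoint_Sets"
begin

record 'a ugraph =
  verts :: "'a set"
  edges :: "'a set set"

definition fin_simple_graph :: "'a ugraph \<Rightarrow> bool" where
  "fin_simple_graph G \<longleftrightarrow> finite (verts G) \<and> edges G \<subseteq> [verts G]\<^bsup>2\<^esup>"

definition nbhd :: "'a ugraph \<Rightarrow> 'a \<Rightarrow> 'a set" where
  "nbhd G x = {y \<in> verts G. {x, y} \<in> edges G}"

definition closed_nbhd :: "'a ugraph \<Rightarrow> 'a \<Rightarrow> 'a set" where
  "closed_nbhd G x = nbhd G x \<union> {x}"

definition delete_verts :: "'a ugraph \<Rightarrow> 'a set \<Rightarrow> 'a ugraph" where
  "delete_verts G S = \<lparr>verts = verts G - S, edges = {e \<in> edges G. e \<inter> S = {}}\<rparr>"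

definition independent_set :: "'a ugraph \<Rightarrow> 'a set \<Rightarrow> bool" where
  "independent_set G S \<longleftrightarrow> S \<subseteq> verts G \<and> indep S (edges G)"

definition maximal_independent_set :: "'a ugraph \<Rightarrow> 'a set \<Rightarrow> bool" where
  "maximal_independent_set G S \<longleftrightarrow>
     independent_set G S \<and> (\<forall>T. independent_set G T \<longrightarrow> S \<subseteq> T \<longrightarrow> T = S)"

definition well_covered :: "'a ugraph \<Rightarrow> bool" where
  "well_covered G \<longleftrightarrow>
     (\<forall>S T. maximal_independent_set G S \<longrightarrow> maximal_independent_set G T \<longrightarrow> card S = card T)"

inductive vertex_decomposable :: "'a ugraph \<Rightarrow> bool" where
  no_edges: "well_covered G \<Longrightarrow> edges G = {} \<Longrightarrow> vertex_decomposable G"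
| shedding: "well_covered G \<Longrightarrow> x \<in> verts G \<Longrightarrow>
    vertex_decomposable (delete_verts G {x}) \<Longrightarrow>
    vertex_decomposable (delete_verts G (closed_nbhd G x)) \<Longrightarrow> vertex_decomposable G"

definition Shed :: "'a ugraph \<Rightarrow> 'a set" where
  "Shed G = {x \<in> verts G. vertex_decomposable (delete_verts G {x}) \<and>
     vertex_decomposable (delete_verts G (closed_nbhd G x))}"

definition dominating_set :: "'a ugraph \<Rightarrow> 'a set \<Rightarrow> bool" where
  "dominating_set G D \<longleftrightarrow> D \<subseteq> verts G \<and> (\<forall>v \<in> verts G - D. \<exists>u \<in> D. {u, v} \<in> edges G)"

definition clique_vertex_partition :: "'a ugraph \<Rightarrow> 'a set set \<Rightarrow> bool" where
  "clique_vertex_partition G \<pi> \<longleftrightarrow> partition_on (verts G) \<pi> \<and> (\<forall>W \<in> \<pi>. clique W (edges G))"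

text \<open>The blocks of a partition are distinct, so they can index the new vertices:
  \<open>Inl x\<close> is the old vertex \<open>x\<close>, and \<open>Inr W\<close> is the new vertex attached to the block \<open>W\<close>.\<close>

definition clique_whisker :: "'a ugraph \<Rightarrow> 'a set set \<Rightarrow> ('a + 'a set) ugraph" where
  "clique_whisker G \<pi> =
     \<lparr>verts = Inl ` verts G \<union> Inr ` \<pi>,
      edges = (\<lambda>e. Inl ` e) ` edges G \<union> {{Inl x, Inr W} | x W. W \<in> \<pi> \<and> x \<in> W}\<rparr>"

lemma fin_simple_graph_clique_whisker:
  assumes "fin_simple_graph G" and "clique_vertex_partition G \<pi>"
  shows "fin_simple_graph (clique_whisker G \<pi>)"
proof -
  have fin: "finite (verts G)" and E: "edges G \<subseteq> [verts G]\<^bsup>2\<^esup>" and P: "\<Union>\<pi> = verts G"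
    using assms by (auto simp: fin_simple_graph_def clique_vertex_partition_def partition_on_def)
  have "finite \<pi>"
    using fin P finite_UnionD by metis
  moreover have "Inl ` e \<in> [Inl ` verts G \<union> Inr ` \<pi>]\<^bsup>2\<^esup>" if "e \<in> edges G" for e
    using that E by (auto simp: nsets_def card_image)
  moreover have "{Inl x, Inr W} \<in> [Inl ` verts G \<union> Inr ` \<pi>]\<^bsup>2\<^esup>" if "W \<in> \<pi>" "x \<in> W" for x W
    using that P by (auto simp: nsets_def)
  ultimately show ?thesis
    using fin by (auto simp: fin_simple_graph_def clique_whisker_def)
qed

end

theory Submission
  imports Defs
begin

text \<open>Call a clique partition of a graph simplicial if every block \<open>B\<close> contains a vertex \<open>w\<close> all of
  whose neighbours lie in \<open>B\<close>. A maximal independent set then meets every block exactly once, so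
  the graph is well-covered. If \<open>x \<noteq> w\<close> lies in the block of \<open>w\<close>, deleting \<open>x\<close> keeps
  the partition simplicial; deleting the closed neighbourhood of \<open>x\<close> removes that block and no
  simplicial vertex of any other block. Hence induction applies and all such \<open>x\<close> are shedding
  vertices. In the whiskered graph the sets \<open>W\<^sub>i \<union> {w\<^sub>i}\<close> form a simplicial partition, so all
  old vertices are shedding.\<close>

definition simplicial_partition :: "'a ugraph \<Rightarrow> 'a set set \<Rightarrow> bool" where
  "simplicial_partition G P \<longleftrightarrow>
     clique_vertex_partition G P \<and> (\<forall>B\<in>P. \<exists>w\<in>B. nbhd G w \<subseteq> B)"

lemma fin_simple_graph_delete_verts:
  assumes "fin_simple_graph G"
  shows "fin_simple_graph (delete_verts G S)"
  using assms by (fastforce simp: fin_simple_graph_def delete_verts_def nsets_def)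

text \<open>A block is a clique, so \<open>S\<close> meets it at most once; maximality of
  \<open>S\<close> and the simplicial vertex of the block force it to meet it at least once. Summing
  over the disjoint blocks gives the count.\<close>

lemma card_maximal_independent_set_simplicial:
  assumes fin: "finite (verts G)" and P: "simplicial_partition G P"
    and S: "maximal_independent_set G S"
  shows "card S = card P"
proof -
  have part: "partition_on (verts G) P"
    using P by (simp add: simplicial_partition_def clique_vertex_partition_def)
  have indS: "S \<subseteq> verts G" "indep S (edges G)"
    and maxS: "\<And>T. independent_set G T \<Longrightarrow> S \<subseteq> T \<Longrightarrow> T = S"
    using S by (auto simp: maximal_independent_set_def independent_set_def)
  have finP: "finite P"
    using part fin finite_elements by blast
  have one: "card (S \<inter> B) = 1" if B: "B \<in> P" for B
  proof -
    obtain w where w: "w \<in> B" "nbhd G w \<subseteq> B"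
      using P B by (auto simp: simplicial_partition_def)
    have wG: "w \<in> verts G"
      using w B partition_onD1[OF part] by auto
    have "S \<inter> B \<noteq> {}"
    proof
      assume disj: "S \<inter> B = {}"
      \<comment> \<open>All neighbours of \<open>w\<close> lie in \<open>B\<close>, which
        \<open>S\<close> misses, so \<open>w\<close> could be added to \<open>S\<close>.\<close>
      have "{w, v} \<notin> edges G" if "v \<in> S" for v
        using that disj w indS(1) by (auto simp: nbhd_def)
      then have "independent_set G (insert w S)"
        using indS wG by (auto simp: independent_set_def indep_def insert_commute)
      from maxS[OF this] disj w show False by auto
    qed
    moreover have "u = v" if "u \<in> S \<inter> B" "v \<in> S \<inter> B" for u v
      using that P B indS(2)
      unfolding simplicial_partition_def clique_vertex_partition_def clique_def indep_def by blast
    ultimately show ?thesis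
      by (metis is_singletonI' is_singleton_altdef)
  qed
  have "S = (\<Union>B\<in>P. S \<inter> B)"
    using indS(1) partition_onD1[OF part] by auto
  also have "card \<dots> = (\<Sum>B\<in>P. card (S \<inter> B))"
  proof (rule card_UN_disjoint[OF finP])
    show "\<forall>B\<in>P. finite (S \<inter> B)"
      using fin indS(1) finite_subset by auto
    show "\<forall>B\<in>P. \<forall>C\<in>P. B \<noteq> C \<longrightarrow> (S \<inter> B) \<inter> (S \<inter> C) = {}"
      using partition_onD2[OF part] by (auto simp: disjoint_def)
  qed
  also have "\<dots> = card P"
    using one by simp
  finally show ?thesis .
qed

lemma well_covered_simplicial:
  assumes "finite (verts G)" "simplicial_partition G P"
  shows "well_covered G"
  using card_maximal_independent_set_simplicial[OF assms] by (simp add: well_covered_def)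

text \<open>Common core of the two deletions. Removing \<open>S\<close> only shrinks neighbourhoods,
  so a simplicial vertex that survives remains simplicial in its trimmed block. Blocks inside
  \<open>S\<close> become empty and are dropped.\<close>

lemma simplicial_partition_delete_verts:
  assumes P: "simplicial_partition G P"
    and S: "\<And>B. B \<in> P \<Longrightarrow> B \<subseteq> S \<or> (\<exists>w\<in>B - S. nbhd G w \<subseteq> B)"
  shows "simplicial_partition (delete_verts G S) ((\<lambda>B. B - S) ` P - {{}})"
proof -
  have part: "partition_on (verts G) P" and cl: "\<forall>B\<in>P. clique B (edges G)"
    using P by (auto simp: simplicial_partition_def clique_vertex_partition_def)
  have "partition_on (verts G - S) ((\<lambda>B. B - S) ` P - {{}})"
    using partition_onD1[OF part] partition_onD2[OF part]
    by (intro partition_onI) (auto simp: disjoint_def disjnt_def)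
  moreover have "clique (B - S) {e \<in> edges G. e \<inter> S = {}}" if "B \<in> P" for B
    using that cl by (auto simp: clique_def)
  moreover have "\<exists>w\<in>B - S. nbhd (delete_verts G S) w \<subseteq> B - S"
    if "B \<in> P" "B - S \<noteq> {}" for B
    using S[OF that(1)] that(2) by (fastforce simp: nbhd_def delete_verts_def)
  ultimately show ?thesis
    by (auto simp: simplicial_partition_def clique_vertex_partition_def delete_verts_def)
qed

text \<open>Only the block \<open>B\<close> of \<open>x\<close> changes, and it keeps its simplicial
  vertex \<open>w\<close>.\<close>

lemma simplicial_partition_delete_vertex:
  assumes P: "simplicial_partition G P" and B: "B \<in> P" "x \<in> B"
    and w: "w \<in> B" "w \<noteq> x" "nbhd G w \<subseteq> B"
  shows "\<exists>Q. simplicial_partition (delete_verts G {x}) Q"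
proof -
  have "C \<subseteq> {x} \<or> (\<exists>v\<in>C - {x}. nbhd G v \<subseteq> C)" if C: "C \<in> P" for C
  proof (cases "C = B")
    case True
    then show ?thesis using w by auto
  next
    case False
    then have "x \<notin> C"
      using P B C by (auto simp: simplicial_partition_def clique_vertex_partition_def
          partition_on_def disjoint_def)
    then show ?thesis
      using P C by (auto simp: simplicial_partition_def)
  qed
  from simplicial_partition_delete_verts[OF P this] show ?thesis by blast
qed

text \<open>The block of \<open>x\<close> is a clique and hence vanishes. Any other block may lose
  vertices, but not its simplicial vertex: that one has no neighbour outside its block, so it is not
  adjacent to \<open>x\<close>.\<close>

lemma simplicial_partition_delete_closed_nbhd:
  assumes P: "simplicial_partition G P" and x: "x \<in> verts G"
  shows "\<exists>Q. simplicial_partition (delete_verts G (closed_nbhd G x)) Q"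
proof -
  have part: "partition_on (verts G) P"
    using P by (simp add: simplicial_partition_def clique_vertex_partition_def)
  have "C \<subseteq> closed_nbhd G x \<or> (\<exists>v\<in>C - closed_nbhd G x. nbhd G v \<subseteq> C)" if C: "C \<in> P" for C
  proof (cases "x \<in> C")
    case True
    moreover have "C \<subseteq> verts G" "clique C (edges G)"
      using P C partition_onD1[OF part]
      by (auto simp: simplicial_partition_def clique_vertex_partition_def)
    ultimately show ?thesis
      by (auto simp: closed_nbhd_def nbhd_def clique_def)
  next
    case False
    obtain v where "v \<in> C" "nbhd G v \<subseteq> C"
      using P C by (auto simp: simplicial_partition_def)
    with False x have "v \<in> C - closed_nbhd G x"
      by (auto simp: closed_nbhd_def nbhd_def insert_commute)
    with \<open>nbhd G v \<subseteq> C\<close> show ?thesis by blast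
  qed
  from simplicial_partition_delete_verts[OF P this] show ?thesis by blast
qed

text \<open>Induction on the number of vertices, for all graphs and partitions at once, since each
  deletion brings its own partition.\<close>

lemma vertex_decomposable_simplicial:
  assumes "fin_simple_graph G" "simplicial_partition G P"
  shows "vertex_decomposable G"
  using assms
proof (induction "card (verts G)" arbitrary: G P rule: less_induct)
  case less
  have fin: "finite (verts G)" and E: "edges G \<subseteq> [verts G]\<^bsup>2\<^esup>"
    using less.prems(1) by (auto simp: fin_simple_graph_def)
  have wc: "well_covered G"
    using well_covered_simplicial[OF fin less.prems(2)] .
  show ?case
  proof (cases "edges G = {}")
    case True
    with wc show ?thesis by (rule no_edges)
  next
    case False
    then obtain a b where ab: "{a, b} \<in> edges G" "a \<noteq> b" "a \<in> verts G" "b \<in> verts G"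
      using E by (force simp: nsets_def card_2_iff)
    have part: "partition_on (verts G) P"
      using less.prems(2) by (simp add: simplicial_partition_def clique_vertex_partition_def)
    obtain B where B: "B \<in> P" "a \<in> B"
      using partition_onD1[OF part] ab by auto
    obtain w where w: "w \<in> B" "nbhd G w \<subseteq> B"
      using less.prems(2) B by (auto simp: simplicial_partition_def)
    \<comment> \<open>The edge guarantees a second vertex in the block of \<open>a\<close>: either
      \<open>a\<close> differs from \<open>w\<close>, or \<open>w = a\<close> and its neighbour
      \<open>b\<close> must lie in \<open>B\<close>.\<close>
    obtain x where x: "x \<in> B" "w \<noteq> x" "x \<in> verts G"
    proof (cases "w = a")
      case True
      then have "b \<in> B" using w(2) ab by (auto simp: nbhd_def)
      with True ab show ?thesis using that by blast
    next
      case False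
      with B ab show ?thesis using that by blast
    qed
    have smaller: "vertex_decomposable (delete_verts G S)"
      if "x \<in> S" "\<exists>Q. simplicial_partition (delete_verts G S) Q" for S
    proof -
      have "card (verts (delete_verts G S)) < card (verts G)"
        using that(1) x(3) fin by (auto simp: delete_verts_def intro!: psubset_card_mono)
      then show ?thesis
        using less.hyps fin_simple_graph_delete_verts[OF less.prems(1)] that(2) by blast
    qed
    show ?thesis
    proof (rule shedding[OF wc x(3)])
      show "vertex_decomposable (delete_verts G {x})"
        using smaller simplicial_partition_delete_vertex[OF less.prems(2) B(1) x(1) w(1) x(2) w(2)]
        by blast
      show "vertex_decomposable (delete_verts G (closed_nbhd G x))"
        using smaller simplicial_partition_delete_closed_nbhd[OF less.prems(2) x(3)]
        by (simp add: closed_nbhd_def)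
    qed
  qed
qed

lemma simplicial_imp_Shed:
  assumes G: "fin_simple_graph G" and P: "simplicial_partition G P"
    and B: "B \<in> P" "x \<in> B" and w: "w \<in> B" "w \<noteq> x" "nbhd G w \<subseteq> B"
  shows "x \<in> Shed G"
proof -
  have x: "x \<in> verts G"
    using P B by (auto simp: simplicial_partition_def clique_vertex_partition_def partition_on_def)
  show ?thesis
    using x simplicial_partition_delete_vertex[OF P B w] simplicial_partition_delete_closed_nbhd[OF P x]
      vertex_decomposable_simplicial fin_simple_graph_delete_verts[OF G]
    by (auto simp: Shed_def)
qed

lemma nbhd_clique_whisker_Inr:
  "nbhd (clique_whisker G \<pi>) (Inr W) \<subseteq> Inl ` W"
  by (auto simp: nbhd_def clique_whisker_def doubleton_eq_iff)

text \<open>Joining each new vertex to its own block keeps the blocks disjoint cliques, and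
  \<open>Inr W\<close> is the simplicial vertex, as it is adjacent only to members of
  \<open>W\<close>.\<close>

lemma simplicial_partition_clique_whisker:
  fixes G :: "'a ugraph"
  assumes "clique_vertex_partition G \<pi>"
  shows "simplicial_partition (clique_whisker G \<pi>) ((\<lambda>W. insert (Inr W) (Inl ` W)) ` \<pi>)"
proof -
  have part: "partition_on (verts G) \<pi>" and cl: "\<And>W. W \<in> \<pi> \<Longrightarrow> clique W (edges G)"
    using assms by (auto simp: clique_vertex_partition_def)
  have "partition_on (verts (clique_whisker G \<pi>)) ((\<lambda>W. insert (Inr W) (Inl ` W)) ` \<pi>)"
  proof (rule partition_onI)
    show "(\<Union>W\<in>\<pi>. insert (Inr W) (Inl ` W)) = verts (clique_whisker G \<pi>)"
      using partition_onD1[OF part] by (auto simp: clique_whisker_def)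
    show "disjnt p q"
      if pq: "p \<in> (\<lambda>W. insert (Inr W) (Inl ` W)) ` \<pi>"
        "q \<in> (\<lambda>W. insert (Inr W) (Inl ` W)) ` \<pi>" "p \<noteq> q"
      for p q :: "('a + 'a set) set"
    proof -
      obtain V W where VW: "V \<in> \<pi>" "W \<in> \<pi>"
          "p = insert (Inr V) (Inl ` V)" "q = insert (Inr W) (Inl ` W)"
        using pq by blast
      with pq have "V \<noteq> W" by auto
      with VW have "V \<inter> W = {}"
        using disjointD[OF partition_onD2[OF part]] by blast
      with VW \<open>V \<noteq> W\<close> show ?thesis by (auto simp: disjnt_def)
    qed
  qed auto
  moreover have "clique (insert (Inr W) (Inl ` W)) (edges (clique_whisker G \<pi>))"
    if W: "W \<in> \<pi>" for W
  proof -
    have "{Inl x, Inl y} \<in> edges (clique_whisker G \<pi>)" if "x \<in> W" "y \<in> W" "x \<noteq> y" for x y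
    proof -
      \<comment> \<open>Written as an image to match the form of the old edges in
        \<open>clique_whisker\<close>.\<close>
      have "Inl ` {x, y} \<in> edges (clique_whisker G \<pi>)"
        using cl[OF W] that unfolding clique_whisker_def clique_def ugraph.simps by blast
      then show ?thesis by simp
    qed
    moreover have "{Inl x, Inr W} \<in> edges (clique_whisker G \<pi>)" if "x \<in> W" for x
      using W that by (auto simp: clique_whisker_def)
    ultimately show ?thesis
      by (auto simp: clique_def insert_commute)
  qed
  ultimately show ?thesis
    using nbhd_clique_whisker_Inr
    by (fastforce simp: simplicial_partition_def clique_vertex_partition_def)
qed

theorem theorem3p3:
  fixes G :: "'a ugraph" and \<pi> :: "'a set set"
  assumes "fin_simple_graph G"
    and "clique_vertex_partition G \<pi>"
  shows "vertex_decomposable (clique_whisker G \<pi>) \<and>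
         dominating_set (clique_whisker G \<pi>) (Shed (clique_whisker G \<pi>))"
proof
  let ?H = "clique_whisker G \<pi>"
  have H: "fin_simple_graph ?H"
    using fin_simple_graph_clique_whisker[OF assms] .
  note P = simplicial_partition_clique_whisker[OF assms(2)]
  show "vertex_decomposable ?H"
    using vertex_decomposable_simplicial[OF H P] .
  have part: "partition_on (verts G) \<pi>"
    using assms(2) by (simp add: clique_vertex_partition_def)
  \<comment> \<open>An old vertex always differs from the simplicial vertex \<open>Inr W\<close> of
    its block.\<close>
  have shed: "Inl x \<in> Shed ?H" if "W \<in> \<pi>" "x \<in> W" for x W
    using that nbhd_clique_whisker_Inr[of G \<pi> W]
    by (intro simplicial_imp_Shed[OF H P, where B = "insert (Inr W) (Inl ` W)" and w = "Inr W"]) auto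
  have "\<exists>u\<in>Shed ?H. {u, v} \<in> edges ?H" if v: "v \<in> verts ?H - Shed ?H" for v
  proof -
    have "v \<notin> Inl ` verts G"
      using v shed partition_onD1[OF part] by auto
    then obtain W where W: "v = Inr W" "W \<in> \<pi>"
      using v by (auto simp: clique_whisker_def)
    \<comment> \<open>Blocks of a partition are nonempty, so each new vertex has an old neighbour,
      which is a shedding vertex.\<close>
    then obtain x where "x \<in> W"
      using partition_onD3[OF part] by (metis all_not_in_conv)
    with W shed show ?thesis
      by (intro bexI[of _ "Inl x"]) (auto simp: clique_whisker_def)
  qed
  then show "dominating_set ?H (Shed ?H)"
    by (auto simp: dominating_set_def Shed_def)
qed

end
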